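(* Consider job scheduling instances $t=1,\dots,T$, where instance $t$ has $n_t$ jobs and prediction error $\eta_t\ge0$, and suppose the average prediction error satisfies $\eta_t/n_t\le B$ for all $t$. Let $$U_t(\lambda)=\min\left\{\frac{1+2\eta_t/n_t}{1-\lambda},\frac2\lambda\right\},\qquad\lambda\in[0,1],$$ be the competitive-ratio upper bounds of the job scheduling problem. Then the exponential forecaster with appropriate step-size, run on the losses $U_1,\dots,U_T$ and playing $\lambda_1,\dots,\lambda_T$, has expected regret $$\max_{\lambda\in[0,1]}\mathbb E\sum_{t=1}^T\big(U_t(\lambda_t)-U_t(\lambda)\big)\le9B\left(1+\sqrt{\frac T2\log T}\right).$$
   Context: Job scheduling with predictions: one is given $n_t$ jobs and their predicted runtimes, with total absolute error $\eta_t$, and must minimize the sum of completion times when running the jobs on a single server with pre-emption. $U_t(\lambda)$ is an upper bound on the competitive ratio of a preferential round-robin algorithm with robustness-consistency trade-off parameter $\lambda$. Division by zero is read as $+\infty$ inside the minimum. Exponential forecaster (exponentially weighted average forecaster) with step-size $\alpha>0$: the action at round $t+1$ is sampled from the distribution on $[0,1]$ with density $\rho_{t+1}(\cdot)\propto\rho_1(\cdot)\exp\big(-\alpha\sum_{s=1}^tU_s(\cdot)\big)$, where $\rho_1$ is the algorithm's initial density (uniform in the standard choice); then $U_{t+1}$ is revealed. "With appropriate step-size" means there is a choice of $\alpha$ for which the inequality holds. The expectation is over the algorithm's sampling.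
   Formalization: B > 0 is assumed (for B = 0 the regret is positive but the bound is 0), and the initial density is uniform only when the claimed bound is at least 1; below that it may be chosen depending on B and T, since for small B the uniform density already loses about 0.91 in round one. *)

theory Defs
  imports "HOL-Probability.Probability"
begin

text \<open>
  The bound is taken in \<^typ>\<open>ereal\<close>, where \<open>inverse 0 = \<infinity>\<close>, so that a vanishing denominator
  contributes \<open>+\<infinity>\<close> to the minimum.  At most one of the two terms is infinite, hence
  \<^const>\<open>real_of_ereal\<close> does not lose anything.
\<close>

definition sched_ratio_bound :: "nat \<Rightarrow> real \<Rightarrow> real \<Rightarrow> real" where
  "sched_ratio_bound n \<eta> x =
     real_of_ereal (min (ereal (1 + 2 * \<eta> / real n) / ereal (1 - x)) (2 / ereal x))"

lemma sched_ratio_bound_0: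
  assumes "\<eta> \<ge> 0"
  shows "sched_ratio_bound n \<eta> 0 = 1 + 2 * \<eta> / real n"
  using assms by (simp add: sched_ratio_bound_def divide_ereal_def min_def)

lemma sched_ratio_bound_1:
  assumes "\<eta> \<ge> 0"
  shows "sched_ratio_bound n \<eta> 1 = 2"
proof -
  have "0 < 1 + \<eta> * 2 / real n"
    using assms by (simp add: add_pos_nonneg)
  then show ?thesis
    using assms by (simp add: sched_ratio_bound_def divide_ereal_def min_def mult.commute)
qed

lemma sched_ratio_bound_interior:
  assumes "0 < x" "x < 1"
  shows "sched_ratio_bound n \<eta> x = min ((1 + 2 * \<eta> / real n) / (1 - x)) (2 / x)"
  using assms by (simp add: sched_ratio_bound_def min_def)

definition density_on_unit :: "(real \<Rightarrow> real) \<Rightarrow> bool" where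
  "density_on_unit \<rho> \<longleftrightarrow>
     \<rho> \<in> borel_measurable borel \<and> (\<forall>x\<in>{0..1}. 0 \<le> \<rho> x) \<and> (LINT x:{0..1}|lborel. \<rho> x) = 1"

definition ef_weight ::
    "(real \<Rightarrow> real) \<Rightarrow> real \<Rightarrow> (nat \<Rightarrow> real \<Rightarrow> real) \<Rightarrow> nat \<Rightarrow> real \<Rightarrow> real" where
  "ef_weight \<rho>1 \<alpha> U t x = \<rho>1 x * exp (- \<alpha> * (\<Sum>s=1..<t. U s x))"

definition ef_density ::
    "(real \<Rightarrow> real) \<Rightarrow> real \<Rightarrow> (nat \<Rightarrow> real \<Rightarrow> real) \<Rightarrow> nat \<Rightarrow> real \<Rightarrow> real" where
  "ef_density \<rho>1 \<alpha> U t x =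
     indicator {0..1} x * ef_weight \<rho>1 \<alpha> U t x / (LINT y:{0..1}|lborel. ef_weight \<rho>1 \<alpha> U t y)"

text \<open>
  \<open>X t\<close> is the action played in round \<open>t\<close>.  The losses are fixed in advance, so the sampling
  density of round \<open>t\<close> is deterministic; no assumption is made on the joint law of the actions
  (in particular, independent sampling is covered).
\<close>

definition exponential_forecaster ::
    "'w measure \<Rightarrow> (real \<Rightarrow> real) \<Rightarrow> real \<Rightarrow> (nat \<Rightarrow> real \<Rightarrow> real) \<Rightarrow> nat \<Rightarrow> (nat \<Rightarrow> 'w \<Rightarrow> real) \<Rightarrow> bool"
  where
  "exponential_forecaster M \<rho>1 \<alpha> U T X \<longleftrightarrow> prob_space M \<and>
     (\<forall>t\<in>{1..T}. distributed M lborel (X t) (\<lambda>x. ennreal (ef_density \<rho>1 \<alpha> U t x)))"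

definition expected_regret ::
    "'w measure \<Rightarrow> (nat \<Rightarrow> real \<Rightarrow> real) \<Rightarrow> nat \<Rightarrow> (nat \<Rightarrow> 'w \<Rightarrow> real) \<Rightarrow> real \<Rightarrow> real" where
  "expected_regret M U T X x = (LINT w|M. (\<Sum>t=1..T. U t (X t w) - U t x))"

text \<open>
  The bound cannot hold for \<open>B = 0\<close>, whatever the initial density is: if \<open>\<eta> t = 0\<close> in every
  round, every loss has its unique minimum at \<open>0\<close>, so the regret of a sampling density is positive.
  For the uniform initial density and such losses, the first round alone costs
  \<open>ln 3 + 2 * ln (3 / 2) - 1\<close> (about \<open>0.91\<close>), so a bound below this value is out of reach for any
  step size.  When \<open>\<eta> t / n t < 1 / 2\<close> in every round, the first round costs the uniform density at
  most \<open>2 - 2 * ln (exp 1 - 1) < 1\<close>; this is why the theorem insists on the uniform initial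
  density as soon as the bound is at least \<open>1\<close>.
\<close>

definition regret_bound :: "real \<Rightarrow> nat \<Rightarrow> real" where
  "regret_bound B T = 9 * B * (1 + sqrt (real T / 2 * ln (real T)))"

end

theory Submission
  imports Defs "HOL-Probability.Hoeffding"
begin

text \<open>
  With \<open>a = 1 + 2 * \<eta> / n\<close>, the loss on the unit interval is \<open>1 / max ((1 - x) / a) (x / 2)\<close>.
  The step size depends on the size of \<open>B\<close>.

  If \<open>B \<ge> 1 / 2\<close>, all losses have range at most \<open>4 * B\<close>, and Hoeffding's lemma bounds the decay of
  the partition functions.  Near the best parameter there is an interval of length \<open>1 / T\<close> on
  which the cumulative loss is within \<open>21 / 2\<close> of the optimum: to the right of any point a loss
  grows at most by the factor \<open>(1 - x) / (1 - y)\<close>, and the optimum is at most \<open>2 * T\<close>, the cumulative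
  loss of \<open>x = 1\<close>.  For \<open>T \<le> 6\<close> the range alone suffices.

  If \<open>B < 1 / 2\<close>, all losses are uniquely minimized at \<open>0\<close>.  With a very large step size, the
  uniform forecaster pays at most \<open>2 - 2 * ln (exp 1 - 1) < 1\<close> in the first round and an arbitrarily
  small amount later.  If the bound is below \<open>1\<close>, an initial density concentrated
  near \<open>0\<close> makes the regret as small as desired.
\<close>

section \<open>The loss on the unit interval in closed form\<close>

lemma sched_ratio_bound_measurable [measurable]: "sched_ratio_bound n \<eta> \<in> borel_measurable borel"
  unfolding sched_ratio_bound_def by measurable

text \<open>As the reciprocal of a maximum, an infinite branch of the minimum becomes a zero inside
  \<open>max\<close>. For \<open>1 \<le> a\<close> the denominator stays positive, so the function
  is continuous up to both endpoints.\<close>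

definition clipped_ratio :: "real \<Rightarrow> real \<Rightarrow> real" where
  "clipped_ratio a x = 1 / max ((1 - x) / a) (x / 2)"

lemma sched_ratio_bound_eq_clipped_ratio:
  assumes "0 \<le> \<eta>" "x \<in> {0..1}"
  shows "sched_ratio_bound n \<eta> x = clipped_ratio (1 + 2 * \<eta> / real n) x"
proof -
  have a: "1 \<le> 1 + 2 * \<eta> / real n" "\<not> 1 + 2 * \<eta> / real n \<le> 0"
    using assms by (simp_all add: add_pos_nonneg not_le)
  consider "x = 0" | "x = 1" | "0 < x" "x < 1" using assms(2) by fastforce
  then show ?thesis
  proof cases
    case 3
    have "min (a / (1 - x)) (2 / x) = 1 / max ((1 - x) / a) (x / 2)" if "1 \<le> a" for a
      using that 3 by (auto simp: min_def max_def field_simps)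
    then show ?thesis
      using a by (simp add: sched_ratio_bound_interior[OF 3] clipped_ratio_def)
  qed (use a assms in \<open>auto simp: sched_ratio_bound_0 sched_ratio_bound_1 clipped_ratio_def max_def\<close>)
qed

text \<open>The falling line \<open>(1 - x) / a\<close> and the rising line \<open>x / 2\<close>
  cross at \<open>x = 2 / (a + 2)\<close>, where both equal \<open>1 / (a + 2)\<close>; their
  maximum is smallest there.\<close>

lemma clipped_ratio_denominator:
  fixes a x :: real
  assumes "1 \<le> a"
  shows "1 / (a + 2) \<le> max ((1 - x) / a) (x / 2)"
proof (cases "x \<le> 2 / (a + 2)")
  case True
  then have "1 / (a + 2) \<le> (1 - x) / a" using assms by (simp add: field_simps)
  then show ?thesis by simp
next
  case False
  then have "1 / (a + 2) \<le> x / 2" using assms by (simp add: field_simps)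
  then show ?thesis by simp
qed

lemma clipped_ratio_denominator_pos:
  fixes a x :: real
  assumes "1 \<le> a"
  shows "0 < max ((1 - x) / a) (x / 2)"
  using clipped_ratio_denominator[OF assms, of x] assms
  by (smt (verit) zero_less_divide_1_iff)

lemma clipped_ratio_le:
  assumes "1 \<le> a"
  shows "clipped_ratio a x \<le> a + 2"
  using clipped_ratio_denominator[OF assms, of x] clipped_ratio_denominator_pos[OF assms, of x] assms
  by (simp add: clipped_ratio_def field_simps)

lemma continuous_on_clipped_ratio:
  assumes "1 \<le> a"
  shows "continuous_on S (clipped_ratio a)"
  unfolding clipped_ratio_def
  using clipped_ratio_denominator_pos[OF assms] assms
  by (intro continuous_intros) (auto simp: less_imp_neq[symmetric])

lemma clipped_ratio_pos:
  assumes "1 \<le> a"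
  shows "0 < clipped_ratio a x"
  using clipped_ratio_denominator_pos[OF assms, of x] unfolding clipped_ratio_def by simp

text \<open>Each branch of the denominator times the left-hand side is at most \<open>1\<close>,
  because \<open>(1 - x) * (1 + \<delta>) \<le> (1 - \<delta>) * (1 + \<delta>) \<le> 1\<close> and
  \<open>x \<le> 1\<close>. With \<open>\<delta> = 0\<close> this gives the lower end of the range
  of the loss; with \<open>\<delta> > 0\<close> and \<open>a < 2\<close> it gives the gap to the
  minimum at \<open>0\<close>.\<close>

lemma clipped_ratio_ge_min:
  assumes "1 \<le> a" "0 \<le> \<delta>" "\<delta> \<le> x" "x \<le> 1"
  shows "min (a * (1 + \<delta>)) 2 \<le> clipped_ratio a x"
proof -
  have "(1 - x) / a * min (a * (1 + \<delta>)) 2 \<le> (1 - x) / a * (a * (1 + \<delta>))"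
    using assms by (intro mult_left_mono) auto
  also have "\<dots> = (1 - x) * (1 + \<delta>)" using assms by simp
  also have "\<dots> \<le> (1 - \<delta>) * (1 + \<delta>)" using assms by (intro mult_right_mono) auto
  also have "\<dots> \<le> 1" by (simp add: algebra_simps)
  finally have 1: "(1 - x) / a * min (a * (1 + \<delta>)) 2 \<le> 1" .
  have "x / 2 * min (a * (1 + \<delta>)) 2 \<le> x / 2 * 2"
    using assms by (intro mult_left_mono) auto
  with assms have 2: "x / 2 * min (a * (1 + \<delta>)) 2 \<le> 1" by simp
  have "max ((1 - x) / a) (x / 2) * min (a * (1 + \<delta>)) 2 \<le> 1"
    using 1 2 by (auto simp: max_def)
  then show ?thesis
    using clipped_ratio_denominator_pos[OF assms(1), of x]
    by (simp add: clipped_ratio_def pos_le_divide_eq mult.commute)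
qed

lemma clipped_ratio_le_left_branch:
  assumes "1 \<le> a" "x < 1"
  shows "clipped_ratio a x \<le> a / (1 - x)"
proof -
  have "1 / max ((1 - x) / a) (x / 2) \<le> 1 / ((1 - x) / a)"
    using assms clipped_ratio_denominator_pos[OF assms(1), of x]
    by (intro divide_left_mono) auto
  then show ?thesis by (simp add: clipped_ratio_def)
qed

lemma clipped_ratio_le_right_branch:
  assumes "1 \<le> a" "0 < x"
  shows "clipped_ratio a x \<le> 2 / x"
proof -
  have "1 / max ((1 - x) / a) (x / 2) \<le> 1 / (x / 2)"
    using assms clipped_ratio_denominator_pos[OF assms(1), of x]
    by (intro divide_left_mono) auto
  then show ?thesis by (simp add: clipped_ratio_def)
qed

lemma clipped_ratio_1: "clipped_ratio a 1 = 2"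
  by (simp add: clipped_ratio_def)

text \<open>Divided by \<open>1 - x\<close>, the branches of the denominator become the constant
  \<open>1 / a\<close> and the increasing function \<open>x / (2 * (1 - x))\<close>, so the quotient
  is nondecreasing in \<open>x\<close>.\<close>

lemma clipped_ratio_right_of:
  assumes "1 \<le> a" "0 \<le> x" "x \<le> y" "y < 1"
  shows "clipped_ratio a y \<le> clipped_ratio a x * ((1 - x) / (1 - y))"
proof -
  have "max ((1 - x) / a) (x / 2) * (1 - y) \<le> max ((1 - y) / a) (y / 2) * (1 - x)"
  proof (cases "(1 - x) / a \<le> x / 2")
    case True
    have "x * (1 - y) \<le> y * (1 - x)" using assms by (simp add: algebra_simps)
    then have "x / 2 * (1 - y) \<le> y / 2 * (1 - x)" by simp
    also have "\<dots> \<le> max ((1 - y) / a) (y / 2) * (1 - x)" 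
      using assms by (intro mult_right_mono) auto
    finally show ?thesis using True by (simp add: max_def)
  next
    case False
    have "(1 - x) / a * (1 - y) = (1 - y) / a * (1 - x)" by simp
    also have "\<dots> \<le> max ((1 - y) / a) (y / 2) * (1 - x)" 
      using assms by (intro mult_right_mono) auto
    finally show ?thesis using False by (simp add: max_def)
  qed
  moreover have "1 / p \<le> 1 / q * (r / s)" if "0 < p" "0 < q" "0 < s" "q * s \<le> p * r" for p q r s :: real
    using that by (simp add: field_simps)
  ultimately show ?thesis
    unfolding clipped_ratio_def
    using clipped_ratio_denominator_pos[OF assms(1)] assms by (metis diff_gt_0_iff_gt)
qed

text \<open>From \<open>2 / 3\<close> on, the branch \<open>2 / x\<close> is the active one even for
  \<open>a = 1\<close>.\<close>

lemma clipped_ratio_right_end: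
  assumes "1 \<le> a" "2 / 3 \<le> x" "x \<le> 1"
  shows "2 \<le> clipped_ratio a x"
proof -
  have "(1 - x) / a \<le> x / 2"
  proof -
    have "1 - x \<le> 1 * (x / 2)" using assms by simp
    also have "\<dots> \<le> a * (x / 2)" using assms by (intro mult_right_mono) auto
    finally show ?thesis using assms by (simp add: field_simps)
  qed
  then show ?thesis using assms by (simp add: clipped_ratio_def max_def field_simps)
qed

section \<open>Auxiliary bounds for \<open>exp 1\<close> and for integrals over the unit
  interval\<close>

text \<open>The value needed later is anything above the larger root
  \<open>(3 + sqrt 5) / 2\<close>, about \<open>2.618\<close>, of \<open>z * z - 3 * z + 1\<close>;
  squaring the quadratic Taylor bound at \<open>1 / 2\<close> is precise enough.\<close>

lemma exp_one_gt: "(2.64::real) < exp 1"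
proof -
  have "(1.625::real) \<le> exp (1 / 2)"
    using exp_lower_Taylor_quadratic[of "1/2 :: real"] by (simp add: power2_eq_square)
  then have "(1.625::real) * 1.625 \<le> exp (1 / 2) * exp (1 / 2)"
    by (intro mult_mono) auto
  then show ?thesis by (simp flip: exp_add)
qed

lemma set_integrable_unit_bounded:
  fixes f :: "real \<Rightarrow> real"
  assumes "f \<in> borel_measurable borel" "\<And>x. x \<in> {0..1} \<Longrightarrow> \<bar>f x\<bar> \<le> C"
  shows "set_integrable lborel {0..1} f"
  unfolding set_integrable_def
proof (rule Bochner_Integration.integrable_bound)
  show "integrable lborel (\<lambda>x. indicator {0..1::real} x * C)"
    by (simp add: integrable_mult_left)
  show "(\<lambda>x. indicator {0..1} x *\<^sub>R f x) \<in> borel_measurable lborel"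
    using assms(1) by simp
  show "AE x in lborel. norm (indicator {0..1} x *\<^sub>R f x) \<le> norm (indicator {0..1::real} x * C)"
    using assms(2) by (intro AE_I2) (force split: split_indicator)
qed

lemma set_integral_unit_mono_sub:
  fixes f :: "real \<Rightarrow> real"
  assumes f: "set_integrable lborel {0..1} f" "\<And>x. x \<in> {0..1} \<Longrightarrow> 0 \<le> f x"
    and "0 \<le> p" "p \<le> q" "q \<le> 1" and c: "\<And>x. x \<in> {p..q} \<Longrightarrow> c \<le> f x"
  shows "(q - p) * c \<le> (LINT x:{0..1}|lborel. f x)"
proof -
  have "(q - p) * c = (LINT x|lborel. indicator {p..q} x * c)"
    using assms by simp
  also have "\<dots> \<le> (LINT x:{0..1}|lborel. f x)"
    unfolding set_lebesgue_integral_def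
  proof (rule integral_mono)
    show "indicator {p..q} x * c \<le> indicator {0..1} x *\<^sub>R f x" for x
      using assms by (auto split: split_indicator)
    show "integrable lborel (\<lambda>x. indicator {p..q} x * c)"
      using assms by (intro integrable_mult_left) simp
  qed (use f in \<open>simp add: set_integrable_def\<close>)
  finally show ?thesis .
qed

section \<open>The exponential forecaster on losses of bounded range\<close>

text \<open>The lower end may change from round to round; Hoeffding's lemma only sees the common
  width \<open>H\<close>.\<close>

locale bounded_losses =
  fixes U :: "nat \<Rightarrow> real \<Rightarrow> real" and T :: nat and lo :: "nat \<Rightarrow> real" and H :: real
  assumes measurable_loss [measurable]: "\<And>t. U t \<in> borel_measurable borel"
    and loss_ge: "\<And>t x. t \<in> {1..T} \<Longrightarrow> x \<in> {0..1} \<Longrightarrow> lo t \<le> U t x"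
    and loss_le: "\<And>t x. t \<in> {1..T} \<Longrightarrow> x \<in> {0..1} \<Longrightarrow> U t x \<le> lo t + H"

locale forecaster_run = bounded_losses U T lo H + prob_space M
  for U T lo H and M :: "'w measure" +
  fixes \<rho> :: "real \<Rightarrow> real" and \<alpha> :: real and X :: "nat \<Rightarrow> 'w \<Rightarrow> real"
  assumes density: "density_on_unit \<rho>"
    and forecaster: "exponential_forecaster M \<rho> \<alpha> U T X"
begin

lemma ef_density_nonneg: "0 \<le> ef_density \<rho> \<alpha> U t x"
proof -
  have *: "0 \<le> ef_weight \<rho> \<alpha> U t y" if "y \<in> {0..1}" for y
    using density that by (auto simp: ef_weight_def density_on_unit_def)
  then have "0 \<le> (LINT y:{0..1}|lborel. ef_weight \<rho> \<alpha> U t y)"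
    unfolding set_lebesgue_integral_def
    by (intro integral_nonneg_AE) (auto split: split_indicator)
  with * show ?thesis
    by (auto simp: ef_density_def split: split_indicator)
qed

lemma action_distributed:
  assumes "t \<in> {1..T}"
  shows "distributed M lborel (X t) (\<lambda>x. ennreal (ef_density \<rho> \<alpha> U t x))"
  using forecaster assms by (simp add: exponential_forecaster_def)

lemma measurable_action [measurable]:
  assumes "t \<in> {1..T}"
  shows "X t \<in> borel_measurable M"
  using distributed_measurable[OF action_distributed[OF assms]] by simp

text \<open>The weights are multiples of \<open>\<rho>\<close>, so the play never leaves the support
  of the initial density. An initial concentration near \<open>0\<close> therefore persists in all
  rounds.\<close>

lemma AE_action:
  assumes "t \<in> {1..T}"
  shows "AE w in M. X t w \<in> {0..1} \<and> \<rho> (X t w) \<noteq> 0"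
proof -
  have [measurable]: "\<rho> \<in> borel_measurable borel"
    using density by (simp add: density_on_unit_def)
  have "AE x in distr M lborel (X t). x \<in> {0..1} \<and> \<rho> x \<noteq> 0"
    unfolding distributed_distr_eq_density[OF action_distributed[OF assms]]
    using distributed_borel_measurable[OF action_distributed[OF assms]]
    by (subst AE_density) (auto simp: ef_density_def ef_weight_def split: split_indicator)
  then show ?thesis
    by (subst (asm) AE_distr_iff) (use assms in auto)
qed

lemma interval_bounded_loss:
  assumes "t \<in> {1..T}"
  shows "interval_bounded_random_variable M (\<lambda>w. U t (X t w)) (lo t) (lo t + H)"
proof unfold_locales
  show "(\<lambda>w. U t (X t w)) \<in> borel_measurable M"
    using measurable_compose[OF measurable_action[OF assms] measurable_loss] .
  show "AE w in M. U t (X t w) \<in> {lo t..lo t + H}"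
    using AE_action[OF assms] by eventually_elim (use loss_ge[OF assms] loss_le[OF assms] in auto)
qed

lemma integrable_loss:
  assumes "t \<in> {1..T}"
  shows "integrable M (\<lambda>w. U t (X t w))"
  using interval_bounded_random_variable.integrable[OF interval_bounded_loss[OF assms]] .

lemma expected_regret_eq:
  "expected_regret M U T X x = (\<Sum>t=1..T. expectation (\<lambda>w. U t (X t w))) - (\<Sum>t=1..T. U t x)"
proof -
  have "expected_regret M U T X x = (\<Sum>t=1..T. expectation (\<lambda>w. U t (X t w) - U t x))"
    unfolding expected_regret_def
    by (intro Bochner_Integration.integral_sum Bochner_Integration.integrable_diff integrable_loss)
      auto
  also have "\<dots> = (\<Sum>t=1..T. expectation (\<lambda>w. U t (X t w)) - U t x)"
    using integrable_loss by (intro sum.cong refl) (simp add: prob_space)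
  finally show ?thesis
    by (simp add: sum_subtractf)
qed

lemma expectation_loss_le:
  assumes "t \<in> {1..T}" "\<And>x. x \<in> {0..1} \<Longrightarrow> \<rho> x \<noteq> 0 \<Longrightarrow> U t x \<le> c"
  shows "expectation (\<lambda>w. U t (X t w)) \<le> c"
  using assms AE_action[OF assms(1)]
  by (intro integral_le_const integrable_loss) auto

end

section \<open>Partition functions of the uniform forecaster\<close>

locale uniform_forecaster_run = forecaster_run U T lo H M "\<lambda>_. 1" \<alpha> X
  for U T lo H and M :: "'w measure" and \<alpha> X +
  assumes step_pos: "0 < \<alpha>"
begin

text \<open>The weight of round \<open>t\<close> counts only the losses before \<open>t\<close>, so
  \<open>partition_function (Suc T)\<close> is the value after all \<open>T\<close> rounds.\<close>

abbreviation partition_function :: "nat \<Rightarrow> real" where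
  "partition_function t \<equiv> LINT y:{0..1}|lborel. ef_weight (\<lambda>_. 1) \<alpha> U t y"

lemma cumulative_loss_ge:
  assumes "t \<le> Suc T" "x \<in> {0..1}"
  shows "(\<Sum>s=1..<t. lo s) \<le> (\<Sum>s=1..<t. U s x)"
  using assms by (intro sum_mono loss_ge) auto

lemma set_integrable_ef_weight:
  assumes "t \<le> Suc T"
  shows "set_integrable lborel {0..1} (ef_weight (\<lambda>_. 1) \<alpha> U t)"
proof (rule set_integrable_unit_bounded)
  show "ef_weight (\<lambda>_. 1) \<alpha> U t \<in> borel_measurable borel"
    unfolding ef_weight_def by measurable
  show "\<bar>ef_weight (\<lambda>_. 1) \<alpha> U t x\<bar> \<le> exp (- \<alpha> * (\<Sum>s=1..<t. lo s))" if "x \<in> {0..1}" for x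
    using cumulative_loss_ge[OF assms that] step_pos by (simp add: ef_weight_def)
qed

lemma partition_function_ge:
  assumes "t \<le> Suc T" "0 \<le> p" "p \<le> q" "q \<le> 1"
    and "\<And>x. x \<in> {p..q} \<Longrightarrow> (\<Sum>s=1..<t. U s x) \<le> c"
  shows "(q - p) * exp (- \<alpha> * c) \<le> partition_function t"
  using assms step_pos
  by (intro set_integral_unit_mono_sub set_integrable_ef_weight) (auto simp: ef_weight_def)

lemma partition_function_pos:
  assumes "t \<le> Suc T"
  shows "0 < partition_function t"
proof -
  have "(\<Sum>s=1..<t. U s x) \<le> (\<Sum>s=1..<t. lo s + H)" if "x \<in> {0..1}" for x
    using assms that by (intro sum_mono loss_le) auto
  then have "(1 - 0) * exp (- \<alpha> * (\<Sum>s=1..<t. lo s + H)) \<le> partition_function t"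
    by (intro partition_function_ge[OF assms]) auto
  then show ?thesis
    by (rule less_le_trans[rotated]) simp
qed

lemma expectation_action:
  assumes "t \<in> {1..T}" "g \<in> borel_measurable borel"
  shows "expectation (\<lambda>w. g (X t w)) = (LINT x|lborel. ef_density (\<lambda>_. 1) \<alpha> U t x * g x)"
  using distributed_integral[OF action_distributed[OF assms(1)], of g] assms(2) ef_density_nonneg
  by simp

text \<open>Multiplying the weight of round \<open>t\<close> by
  \<open>exp (- \<alpha> * U t x)\<close> turns it into the weight of round
  \<open>Suc t\<close>.\<close>

lemma expectation_exp_loss:
  assumes "t \<in> {1..T}"
  shows "expectation (\<lambda>w. exp (- \<alpha> * U t (X t w))) = partition_function (Suc t) / partition_function t"
proof -
  have "expectation (\<lambda>w. exp (- \<alpha> * U t (X t w))) =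
      (LINT x|lborel. ef_density (\<lambda>_. 1) \<alpha> U t x * exp (- \<alpha> * U t x))"
    using expectation_action[OF assms, of "\<lambda>x. exp (- \<alpha> * U t x)"] by simp
  also have "\<dots> = (LINT x|lborel. (indicator {0..1} x *\<^sub>R ef_weight (\<lambda>_. 1) \<alpha> U (Suc t) x) / partition_function t)"
    using assms
    by (intro Bochner_Integration.integral_cong)
      (auto simp: ef_density_def ef_weight_def algebra_simps simp flip: exp_add)
  finally show ?thesis
    by (simp add: set_lebesgue_integral_def)
qed

lemma partition_function_step:
  assumes t: "t \<in> {1..T}"
  shows "partition_function (Suc t) \<le>
    partition_function t * exp (- \<alpha> * expectation (\<lambda>w. U t (X t w)) + \<alpha>\<^sup>2 * H\<^sup>2 / 8)"
proof -
  let ?m = "expectation (\<lambda>w. U t (X t w))"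
  interpret loss: interval_bounded_random_variable M "\<lambda>w. U t (X t w)" "lo t" "lo t + H"
    by (rule interval_bounded_loss[OF t])
  note [measurable] = loss.random_variable
  \<comment> \<open>Hoeffding's lemma is stated for positive multiples of a centered variable, so it
    is applied to the negated loss, whose range has the same width.\<close>
  interpret neg: interval_bounded_random_variable M "\<lambda>w. - U t (X t w)" "- (lo t + H)" "- lo t"
  proof unfold_locales
    show "AE w in M. - U t (X t w) \<in> {- (lo t + H)..- lo t}"
      using loss.AE_in_interval by eventually_elim auto
    show "(\<lambda>w. - U t (X t w)) \<in> borel_measurable M"
      using loss.random_variable by (rule borel_measurable_uminus)
  qed
  have "nn_integral M (\<lambda>w. exp (\<alpha> * (- U t (X t w) - expectation (\<lambda>w. - U t (X t w)))))
      \<le> ennreal (exp (\<alpha>\<^sup>2 * (- lo t - (- (lo t + H)))\<^sup>2 / 8))"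
    by (rule neg.Hoeffdings_lemma_nn_integral[OF step_pos])
  then have "nn_integral M (\<lambda>w. ennreal (exp (\<alpha> * ?m) * exp (- \<alpha> * U t (X t w))))
      \<le> ennreal (exp (\<alpha>\<^sup>2 * H\<^sup>2 / 8))"
    by (simp add: algebra_simps flip: exp_add)
  then have "expectation (\<lambda>w. exp (\<alpha> * ?m) * exp (- \<alpha> * U t (X t w))) \<le> exp (\<alpha>\<^sup>2 * H\<^sup>2 / 8)"
    by (subst integral_eq_nn_integral) (auto intro!: enn2real_leI)
  then have "exp (\<alpha> * ?m) * (partition_function (Suc t) / partition_function t) \<le> exp (\<alpha>\<^sup>2 * H\<^sup>2 / 8)"
    using expectation_exp_loss[OF t] by simp
  then show ?thesis
    using partition_function_pos[of t] t
    unfolding exp_add minus_mult_left[symmetric] exp_minus by (simp add: field_simps)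
qed

text \<open>The one-round bounds telescope, starting from \<open>partition_function 1 = 1\<close>
  for the uniform density.\<close>

lemma partition_function_le:
  assumes "t \<le> T"
  shows "partition_function (Suc t) \<le>
    exp (- \<alpha> * (\<Sum>s=1..t. expectation (\<lambda>w. U s (X s w))) + t * (\<alpha>\<^sup>2 * H\<^sup>2 / 8))"
  using assms
proof (induction t)
  case 0
  then show ?case by (simp add: ef_weight_def set_integral_const)
next
  case (Suc t)
  let ?m = "\<lambda>s. expectation (\<lambda>w. U s (X s w))"
  have "partition_function (Suc (Suc t)) \<le>
      partition_function (Suc t) * exp (- \<alpha> * ?m (Suc t) + \<alpha>\<^sup>2 * H\<^sup>2 / 8)"
    using Suc.prems by (intro partition_function_step) auto
  also have "\<dots> \<le> exp (- \<alpha> * (\<Sum>s=1..t. ?m s) + t * (\<alpha>\<^sup>2 * H\<^sup>2 / 8)) *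
      exp (- \<alpha> * ?m (Suc t) + \<alpha>\<^sup>2 * H\<^sup>2 / 8)"
    using Suc by (intro mult_right_mono) auto
  also have "\<dots> = exp (- \<alpha> * (\<Sum>s=1..Suc t. ?m s) + Suc t * (\<alpha>\<^sup>2 * H\<^sup>2 / 8))"
    by (simp add: algebra_simps flip: exp_add)
  finally show ?case .
qed

text \<open>The final partition function lies between the mass of an interval with small cumulative
  loss and the Hoeffding bound; taking logarithms compares the two. The length of the interval takes
  the place of one over the number of experts.\<close>

lemma total_expected_loss_le:
  assumes "0 \<le> p" "p < q" "q \<le> 1" and "\<And>x. x \<in> {p..q} \<Longrightarrow> (\<Sum>s=1..T. U s x) \<le> c"
  shows "(\<Sum>t=1..T. expectation (\<lambda>w. U t (X t w))) \<le> c + ln (1 / (q - p)) / \<alpha> + \<alpha> * T * H\<^sup>2 / 8"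
proof -
  let ?S = "\<Sum>t=1..T. expectation (\<lambda>w. U t (X t w))"
  have "(q - p) * exp (- \<alpha> * c) \<le> partition_function (Suc T)"
    using assms by (intro partition_function_ge) (auto simp: atLeastLessThanSuc_atLeastAtMost)
  also have "\<dots> \<le> exp (- \<alpha> * ?S + T * (\<alpha>\<^sup>2 * H\<^sup>2 / 8))"
    by (rule partition_function_le) simp
  finally have "ln ((q - p) * exp (- \<alpha> * c)) \<le> ln (exp (- \<alpha> * ?S + T * (\<alpha>\<^sup>2 * H\<^sup>2 / 8)))"
    using assms(2) by (intro ln_mono) auto
  then have "ln (q - p) - \<alpha> * c \<le> - \<alpha> * ?S + T * (\<alpha>\<^sup>2 * H\<^sup>2 / 8)"
    using assms(2) by (simp add: ln_mult)
  then have "\<alpha> * ?S \<le> \<alpha> * c + ln (1 / (q - p)) + T * (\<alpha>\<^sup>2 * H\<^sup>2 / 8)"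
    using assms(2) by (simp add: ln_div)
  also have "\<dots> = \<alpha> * (c + ln (1 / (q - p)) / \<alpha> + \<alpha> * T * H\<^sup>2 / 8)"
    using step_pos by (simp add: field_simps power2_eq_square)
  finally show ?thesis
    using step_pos by simp
qed

end

section \<open>Cumulative scheduling losses and their minimizers\<close>

locale scheduling_instances =
  fixes B :: real and T :: nat and n :: "nat \<Rightarrow> nat" and \<eta> :: "nat \<Rightarrow> real"
  assumes instances: "\<And>t. t \<in> {1..T} \<Longrightarrow> 1 \<le> n t \<and> 0 \<le> \<eta> t \<and> \<eta> t / real (n t) \<le> B"
begin

abbreviation U :: "nat \<Rightarrow> real \<Rightarrow> real" where
  "U \<equiv> \<lambda>t. sched_ratio_bound (n t) (\<eta> t)"

definition a :: "nat \<Rightarrow> real" where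
  "a t = 1 + 2 * \<eta> t / real (n t)"

text \<open>The loss lies between \<open>min (a t) 2\<close> and \<open>a t + 2\<close>, and these
  differ by \<open>max 2 (a t)\<close>.\<close>

abbreviation range_width :: real where
  "range_width \<equiv> max 2 (1 + 2 * B)"

lemma a_bounds:
  assumes "t \<in> {1..T}"
  shows "1 \<le> a t" "a t \<le> 1 + 2 * B"
  using instances[OF assms] by (auto simp: a_def)

lemma U_eq:
  assumes "t \<in> {1..T}" "x \<in> {0..1}"
  shows "U t x = clipped_ratio (a t) x"
  using instances[OF assms(1)] assms(2) by (simp add: sched_ratio_bound_eq_clipped_ratio a_def)

sublocale bounded_losses U T "\<lambda>t. min (a t) 2" range_width
proof
  fix t x assume t: "t \<in> {1..T}" and x: "x \<in> {0..1::real}"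
  show "min (a t) 2 \<le> U t x"
    using clipped_ratio_ge_min[of "a t" 0 x] a_bounds[OF t] x by (simp add: U_eq[OF t x])
  show "U t x \<le> min (a t) 2 + range_width"
    using clipped_ratio_le[of "a t" x] a_bounds[OF t] by (simp add: U_eq[OF t x])
qed simp

text \<open>Continuity on a compact interval; it is available for \<open>clipped_ratio\<close>, with
  which \<open>U\<close> agrees there.\<close>

lemma ex_best_parameter: "\<exists>xm\<in>{0..1}. \<forall>x\<in>{0..1}. (\<Sum>t=1..T. U t xm) \<le> (\<Sum>t=1..T. U t x)"
proof -
  have "continuous_on {0..1} (\<lambda>x. \<Sum>t=1..T. clipped_ratio (a t) x)"
    by (intro continuous_on_sum continuous_on_clipped_ratio a_bounds)
  then have "\<exists>xm\<in>{0..1}. \<forall>x\<in>{0..1}.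
      (\<Sum>t=1..T. clipped_ratio (a t) xm) \<le> (\<Sum>t=1..T. clipped_ratio (a t) x)"
    by (intro continuous_attains_inf) auto
  moreover have "(\<Sum>t=1..T. U t x) = (\<Sum>t=1..T. clipped_ratio (a t) x)" if "x \<in> {0..1}" for x
    using that by (intro sum.cong refl) (simp add: U_eq)
  ultimately show ?thesis by simp
qed

lemma total_loss_1: "(\<Sum>t=1..T. U t 1) = 2 * real T"
proof -
  have "(\<Sum>t=1..T. U t 1) = (\<Sum>t=1..T. 2)"
    by (intro sum.cong refl) (simp add: U_eq clipped_ratio_1)
  then show ?thesis by simp
qed

text \<open>Up to \<open>2 / 3\<close> there is room to the right of \<open>xm\<close>. Beyond that
  point every loss at \<open>xm\<close> is at least \<open>2\<close>, the loss of
  \<open>x = 1\<close>, so an interval ending at \<open>1\<close> serves instead.\<close>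

lemma near_best_interval:
  fixes xm w :: real
  assumes xm: "xm \<in> {0..1}" "\<And>x. x \<in> {0..1} \<Longrightarrow> (\<Sum>t=1..T. U t xm) \<le> (\<Sum>t=1..T. U t x)"
    and w: "0 < w" "w < 1 / 3"
  obtains p where "0 \<le> p" "p + w \<le> 1"
    "\<And>y. y \<in> {p..p + w} \<Longrightarrow> (\<Sum>t=1..T. U t y) \<le> (\<Sum>t=1..T. U t xm) + 6 * T * w / (1 - 3 * w)"
proof (cases "xm \<le> 2 / 3")
  case True
  show thesis
  proof (rule that[of xm])
    show "0 \<le> xm" "xm + w \<le> 1" using xm True w by auto
    fix y assume y: "y \<in> {xm..xm + w}"
    have ratio: "(1 - xm) / (1 - y) \<le> 1 / (1 - 3 * w)"
    proof -
      \<comment> \<open>Here \<open>xm \<le> 2 / 3\<close> makes \<open>3 * (1 - xm)\<close> at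
        least \<open>1\<close>.\<close>
      have "w * 1 \<le> w * (3 * (1 - xm))" using True w by (intro mult_left_mono) auto
      then have "(1 - xm) * (1 - 3 * w) \<le> 1 - y" using y by (simp add: algebra_simps)
      then show ?thesis using y True w by (simp add: field_simps)
    qed
    have "U t y \<le> U t xm * (1 / (1 - 3 * w))" if t: "t \<in> {1..T}" for t
    proof -
      have "clipped_ratio (a t) y \<le> clipped_ratio (a t) xm * ((1 - xm) / (1 - y))"
        using a_bounds[OF t] y xm True w by (intro clipped_ratio_right_of) auto
      also have "\<dots> \<le> clipped_ratio (a t) xm * (1 / (1 - 3 * w))"
        using clipped_ratio_pos[OF a_bounds(1)[OF t], of xm] ratio by (intro mult_left_mono) auto
      finally show ?thesis
        using y xm True w by (simp add: U_eq[OF t])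
    qed
    then have "(\<Sum>t=1..T. U t y) \<le> (\<Sum>t=1..T. U t xm) * (1 / (1 - 3 * w))"
      by (subst sum_distrib_right) (intro sum_mono)
    also have "\<dots> = (\<Sum>t=1..T. U t xm) + (\<Sum>t=1..T. U t xm) * (3 * w / (1 - 3 * w))"
      using w by (simp add: field_simps)
    \<comment> \<open>The optimum is at most the cumulative loss of \<open>x = 1\<close>.\<close>
    also have "(\<Sum>t=1..T. U t xm) * (3 * w / (1 - 3 * w)) \<le> 2 * T * (3 * w / (1 - 3 * w))"
      using xm(2)[of 1] total_loss_1 w by (intro mult_right_mono) auto
    finally show "(\<Sum>t=1..T. U t y) \<le> (\<Sum>t=1..T. U t xm) + 6 * T * w / (1 - 3 * w)"
      by (simp add: mult_ac)
  qed
next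
  case False
  show thesis
  proof (rule that[of "1 - w"])
    show "0 \<le> 1 - w" "1 - w + w \<le> 1" using w by auto
    fix y assume y: "y \<in> {1 - w..1 - w + w}"
    have "U t y \<le> 2 + 6 * w / (1 - 3 * w)" if t: "t \<in> {1..T}" for t
    proof -
      have "U t y \<le> 2 / y"
        using clipped_ratio_le_right_branch[of "a t" y] a_bounds[OF t] y w by (simp add: U_eq[OF t])
      \<comment> \<open>Since \<open>y \<ge> 1 - w\<close>, this is weaker than necessary, but it
        matches the error term of the other case.\<close>
      also have "\<dots> \<le> 2 / (1 - 3 * w)" using y w by (intro divide_left_mono) auto
      also have "\<dots> = 2 + 6 * w / (1 - 3 * w)" using w by (simp add: field_simps)
      finally show ?thesis .
    qed
    then have "(\<Sum>t=1..T. U t y) \<le> (\<Sum>t=1..T. 2 + 6 * w / (1 - 3 * w))"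
      by (intro sum_mono)
    also have "\<dots> = (\<Sum>t=1..T. 2) + 6 * T * w / (1 - 3 * w)"
      by (simp add: algebra_simps)
    also have "(\<Sum>t=1..T. 2) \<le> (\<Sum>t=1..T. U t xm)"
      using clipped_ratio_right_end[of _ xm] a_bounds False xm(1)
      by (intro sum_mono) (simp add: U_eq)
    finally show "(\<Sum>t=1..T. U t y) \<le> (\<Sum>t=1..T. U t xm) + 6 * T * w / (1 - 3 * w)"
      by simp
  qed
qed

text \<open>The regret against \<open>x\<close> is a constant minus the cumulative loss of
  \<open>x\<close>, so it is largest at a minimizer of that loss.\<close>

lemma regret_max_attained:
  assumes "forecaster_run U T (\<lambda>t. min (a t) 2) range_width M \<rho> \<alpha> X"
    and "\<And>xm. \<lbrakk>xm \<in> {0..1}; \<And>x. x \<in> {0..1} \<Longrightarrow> (\<Sum>t=1..T. U t xm) \<le> (\<Sum>t=1..T. U t x)\<rbrakk> \<Longrightarrow>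
      (\<Sum>t=1..T. LINT w|M. U t (X t w)) - (\<Sum>t=1..T. U t xm) \<le> R"
  shows "\<exists>xm\<in>{0..1}. (\<forall>x\<in>{0..1}. expected_regret M U T X x \<le> expected_regret M U T X xm) \<and>
    expected_regret M U T X xm \<le> R"
proof -
  interpret forecaster_run U T "\<lambda>t. min (a t) 2" range_width M \<rho> \<alpha> X by fact
  obtain xm where "xm \<in> {0..1}" "\<And>x. x \<in> {0..1} \<Longrightarrow> (\<Sum>t=1..T. U t xm) \<le> (\<Sum>t=1..T. U t x)"
    using ex_best_parameter by blast
  with assms(2)[of xm] show ?thesis
    by (intro bexI[of _ xm]) (auto simp: expected_regret_eq)
qed

text \<open>For \<open>B < 1 / 2\<close> every \<open>a t\<close> is below \<open>2\<close>, so the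
  lower end \<open>min (a t) 2\<close> is \<open>a t\<close>, the loss at \<open>0\<close>.\<close>

lemma minimal_loss_ge:
  assumes "B < 1 / 2" "x \<in> {0..1}"
  shows "(\<Sum>t=1..T. a t) \<le> (\<Sum>t=1..T. U t x)"
proof (intro sum_mono)
  fix t assume "t \<in> {1..T}"
  then show "a t \<le> U t x"
    using loss_ge[OF _ assms(2), of t] a_bounds(2)[of t] assms(1) by simp
qed

lemma U_near_0:
  assumes "t \<in> {1..T}" "B < 1 / 2" "0 \<le> x" "x \<le> \<delta>" "\<delta> \<le> 1 / 2"
  shows "U t x \<le> a t + 4 * \<delta>"
proof -
  have "U t x \<le> a t / (1 - x)"
    using clipped_ratio_le_left_branch[of "a t" x] a_bounds[OF assms(1)] assms
    by (simp add: U_eq)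
  also have "\<dots> \<le> a t + 4 * \<delta>"
  proof -
    have "a t * \<delta> + 4 * \<delta> * \<delta> \<le> 2 * \<delta> + 4 * \<delta> * (1 / 2)"
      using a_bounds[OF assms(1)] assms by (intro add_mono mult_mono) auto
    then have "a t \<le> (a t + 4 * \<delta>) * (1 - \<delta>)"
      by (simp add: algebra_simps)
    also have "\<dots> \<le> (a t + 4 * \<delta>) * (1 - x)"
      using a_bounds[OF assms(1)] assms by (intro mult_left_mono) auto
    finally show ?thesis using assms by (simp add: field_simps)
  qed
  finally show ?thesis .
qed

text \<open>The gap is at least \<open>min (a t * \<delta>) (2 - a t)\<close>, and
  \<open>1 \<le> a t \<le> 1 + 2 * B\<close>.\<close>

lemma U_away_from_0:
  assumes "t \<in> {1..T}" "B < 1 / 2" "0 \<le> \<delta>" "\<delta> \<le> x" "x \<le> 1"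
  shows "a t + min \<delta> (1 - 2 * B) \<le> U t x"
proof -
  have "1 * \<delta> \<le> a t * \<delta>" using a_bounds[OF assms(1)] assms by (intro mult_right_mono) auto
  then have "a t + min \<delta> (1 - 2 * B) \<le> min (a t * (1 + \<delta>)) 2"
    using a_bounds[OF assms(1)] by (simp add: algebra_simps min_def)
  also have "\<dots> \<le> U t x"
    using clipped_ratio_ge_min[of "a t" \<delta> x] a_bounds[OF assms(1)] assms by (simp add: U_eq)
  finally show ?thesis .
qed

end

section \<open>Cost of the uniform density in the first round\<close>

text \<open>Both branches bound the loss from above, so any split point that does not depend on
  \<open>a\<close> gives a bound for all \<open>a\<close>. Splitting at \<open>1 - exp (- 1)\<close>
  makes the integral of the left branch exactly \<open>a\<close>.\<close>

lemma set_integral_clipped_ratio_le: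
  assumes "1 \<le> a"
  shows "(LINT x:{0..1}|lborel. clipped_ratio a x) \<le> a + (2 - 2 * ln (exp 1 - 1))"
proof -
  \<comment> \<open>The maximum over \<open>a\<close> of the excess is attained at \<open>a = 2 / (exp 1 - 1)\<close>, where the two
    branches meet at this \<open>c\<close>.\<close>
  define c :: real where "c = 1 - exp (- 1)"
  have c: "0 < c" "c < 1" by (auto simp: c_def)
  have ln_c: "ln c = ln (exp 1 - 1) - 1"
  proof -
    have "c = (exp 1 - 1) / exp 1" by (simp add: c_def exp_minus field_simps)
    then show ?thesis by (simp add: ln_div)
  qed
  have cont: "continuous_on {0..1} (clipped_ratio a)"
    by (rule continuous_on_clipped_ratio[OF assms])
  have "((\<lambda>x. a / (1 - x)) has_integral (- a * ln (1 - c) - (- a * ln (1 - 0)))) {0..c}"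
    using c
    by (intro fundamental_theorem_of_calculus)
      (auto intro!: derivative_eq_intros simp flip: has_real_derivative_iff_has_vector_derivative)
  then have "integral {0..c} (clipped_ratio a) \<le> - a * ln (1 - c) - (- a * ln (1 - 0))"
    using c assms
    by (intro has_integral_le[OF integrable_integral] integrable_continuous_real
        continuous_on_clipped_ratio) (auto intro: clipped_ratio_le_left_branch)
  then have 1: "integral {0..c} (clipped_ratio a) \<le> a"
    by (simp add: c_def)
  have "((\<lambda>x. 2 / x) has_integral (2 * ln 1 - 2 * ln c)) {c..1}"
    using c
    by (intro fundamental_theorem_of_calculus)
      (auto intro!: derivative_eq_intros simp flip: has_real_derivative_iff_has_vector_derivative)
  then have "integral {c..1} (clipped_ratio a) \<le> 2 * ln 1 - 2 * ln c"
    using c assms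
    by (intro has_integral_le[OF integrable_integral] integrable_continuous_real
        continuous_on_clipped_ratio) (auto intro: clipped_ratio_le_right_branch)
  then have 2: "integral {c..1} (clipped_ratio a) \<le> 2 - 2 * ln (exp 1 - 1)"
    by (simp add: ln_c)
  have "(LINT x:{0..1}|lborel. clipped_ratio a x) = integral {0..1} (clipped_ratio a)"
    by (intro set_borel_integral_eq_integral borel_integrable_atLeastAtMost' cont)
  also have "\<dots> = integral {0..c} (clipped_ratio a) + integral {c..1} (clipped_ratio a)"
    using c cont by (intro Henstock_Kurzweil_Integration.integral_combine[symmetric] integrable_continuous_real) auto
  finally show ?thesis using 1 2 by simp
qed

lemma first_round_constant_less_1: "2 - 2 * ln (exp 1 - 1) < (1::real)"
proof -
  \<comment> \<open>The product supplied below is \<open>z * z - 3 * z + 0.9504\<close> at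
    \<open>z = exp 1\<close>; its positivity implies the claim
    \<open>z * z - 3 * z + 1 > 0\<close>.\<close>
  have "exp 1 < (exp 1 - 1) * (exp 1 - 1 :: real)"
    using mult_pos_pos[of "exp 1 - 2.64 :: real" "exp 1 - 0.36"] exp_one_gt
    by (simp add: field_simps)
  then have "ln (exp 1) < ln ((exp 1 - 1) * (exp 1 - 1 :: real))"
    using exp_one_gt by (intro ln_less_cancel_iff[THEN iffD2]) auto
  then show ?thesis
    using exp_one_gt by (simp add: ln_mult)
qed

section \<open>Regret bounds for the different sizes of \<open>B\<close> and
  \<open>T\<close>\<close>

locale scheduling_run =
  scheduling_instances B T n \<eta> +
  forecaster_run U T "\<lambda>t. min (a t) 2" "max 2 (1 + 2 * B)" M \<rho> \<alpha> X
  for B T n \<eta> and M :: "'w measure" and \<rho> \<alpha> X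
begin

text \<open>All actions stay in \<open>{0..\<delta>}\<close>, where each loss exceeds its minimum
  \<open>a t\<close> by at most \<open>4 * \<delta>\<close>.\<close>

lemma regret_le_near_0:
  assumes "B < 1 / 2" "0 \<le> \<delta>" "\<delta> \<le> 1 / 2" "xm \<in> {0..1}"
    and support: "\<And>x. \<rho> x \<noteq> 0 \<Longrightarrow> x \<le> \<delta>"
  shows "(\<Sum>t=1..T. LINT w|M. U t (X t w)) - (\<Sum>t=1..T. U t xm) \<le> 4 * \<delta> * T"
proof -
  have "(\<Sum>t=1..T. LINT w|M. U t (X t w)) \<le> (\<Sum>t=1..T. a t + 4 * \<delta>)"
    using assms by (intro sum_mono expectation_loss_le U_near_0) auto
  also have "\<dots> = (\<Sum>t=1..T. a t) + 4 * \<delta> * T"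
    by (simp add: sum.distrib)
  finally show ?thesis
    using minimal_loss_ge[OF assms(1,4)] by simp
qed

lemma regret_le_range:
  assumes "xm \<in> {0..1}"
  shows "(\<Sum>t=1..T. LINT w|M. U t (X t w)) - (\<Sum>t=1..T. U t xm) \<le> max 2 (1 + 2 * B) * T"
proof -
  have "(\<Sum>t=1..T. LINT w|M. U t (X t w)) \<le> (\<Sum>t=1..T. min (a t) 2 + max 2 (1 + 2 * B))"
    by (intro sum_mono expectation_loss_le loss_le) auto
  also have "\<dots> = (\<Sum>t=1..T. min (a t) 2) + max 2 (1 + 2 * B) * T"
    by (simp add: sum.distrib)
  also have "(\<Sum>t=1..T. min (a t) 2) \<le> (\<Sum>t=1..T. U t xm)"
    using assms by (intro sum_mono loss_ge)
  finally show ?thesis by simp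
qed

end

locale uniform_scheduling_run =
  scheduling_instances B T n \<eta> +
  uniform_forecaster_run U T "\<lambda>t. min (a t) 2" "max 2 (1 + 2 * B)" M \<alpha> X
  for B T n \<eta> and M :: "'w measure" and \<alpha> X
begin

sublocale scheduling_run B T n \<eta> M "\<lambda>_. 1" \<alpha> X ..

text \<open>Each past loss is at least \<open>a s + g\<close> at \<open>x\<close>, but at most
  \<open>a s + g / 2\<close> on \<open>{0..g / 8}\<close>, whose mass bounds the normalizer from
  below. From round \<open>2\<close> on at least one loss has been observed, so a factor
  \<open>exp (- \<alpha> * g / 2)\<close> remains.\<close>

lemma ef_density_le_away_from_0:
  assumes "t \<in> {2..T}" "B < 1 / 2" "0 < \<delta>" "\<delta> \<le> 1 / 2" "\<delta> \<le> x" "x \<le> 1"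
  defines "g \<equiv> min \<delta> (1 - 2 * B)"
  shows "ef_density (\<lambda>_. 1) \<alpha> U t x \<le> exp (- \<alpha> * g / 2) / (g / 8)"
proof -
  define A where "A = (\<Sum>s=1..<t. a s)"
  have "g \<le> \<delta>" by (simp add: g_def)
  then have g: "0 < g" "g \<le> 1 / 2" using assms(2-4) by (simp add: g_def, linarith)
  have t: "1 \<le> t - 1" using assms(1) by auto
  \<comment> \<open>The length \<open>g / 8\<close> makes the excess \<open>4 * (g / 8)\<close> from
    \<open>U_near_0\<close> half of the gap \<open>g\<close>.\<close>
  have "(\<Sum>s=1..<t. U s y) \<le> A + (t - 1) * (g / 2)" if "y \<in> {0..g / 8}" for y
  proof -
    have "(\<Sum>s=1..<t. U s y) \<le> (\<Sum>s=1..<t. a s + 4 * (g / 8))"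
      using assms(1,2) g that by (intro sum_mono U_near_0) auto
    then show ?thesis by (simp add: sum.distrib A_def)
  qed
  then have W: "(g / 8 - 0) * exp (- \<alpha> * (A + (t - 1) * (g / 2))) \<le> partition_function t"
    using assms(1) g by (intro partition_function_ge) auto
  have "A + (t - 1) * g \<le> (\<Sum>s=1..<t. U s x)"
  proof -
    have "(\<Sum>s=1..<t. a s + g) \<le> (\<Sum>s=1..<t. U s x)"
      unfolding g_def using assms(1-6) by (intro sum_mono U_away_from_0) auto
    then show ?thesis by (simp add: sum.distrib A_def)
  qed
  then have N: "ef_weight (\<lambda>_. 1) \<alpha> U t x \<le> exp (- \<alpha> * (A + (t - 1) * g))"
    using step_pos by (simp add: ef_weight_def)
  have "ef_density (\<lambda>_. 1) \<alpha> U t x = ef_weight (\<lambda>_. 1) \<alpha> U t x / partition_function t"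
    using assms by (simp add: ef_density_def)
  also have "\<dots> \<le> exp (- \<alpha> * (A + (t - 1) * g)) / ((g / 8 - 0) * exp (- \<alpha> * (A + (t - 1) * (g / 2))))"
    using N W g by (intro frac_le) auto
  also have "\<dots> = exp (- \<alpha> * (t - 1) * (g / 2)) / (g / 8)"
  proof -
    have "exp (- \<alpha> * (A + (t - 1) * g)) =
        exp (- \<alpha> * (t - 1) * (g / 2)) * exp (- \<alpha> * (A + (t - 1) * (g / 2)))"
      unfolding exp_add[symmetric] by (rule arg_cong[of _ _ exp]) (simp add: algebra_simps)
    then show ?thesis using g by simp
  qed
  also have "\<dots> \<le> exp (- \<alpha> * g / 2) / (g / 8)"
  proof -
    have "\<alpha> * g / 2 * 1 \<le> \<alpha> * g / 2 * (t - 1)"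
      using step_pos g t by (intro mult_left_mono) auto
    then show ?thesis using g by (intro divide_right_mono) (auto simp: algebra_simps)
  qed
  finally show ?thesis .
qed

text \<open>Up to \<open>\<delta>\<close> the loss is at most \<open>a t + 4 * \<delta>\<close>.
  Beyond \<open>\<delta>\<close> it is at most \<open>a t + 2\<close>, but the density there is at
  most \<open>K\<close>, which costs at most \<open>2 * K\<close> over the unit interval.\<close>

lemma expectation_loss_concentrated:
  assumes t: "t \<in> {2..T}" and "B < 1 / 2" and \<delta>: "0 < \<delta>" "\<delta> \<le> 1 / 2"
    and g: "g = min \<delta> (1 - 2 * B)" and K: "exp (- \<alpha> * g / 2) / (g / 8) \<le> K"
  shows "expectation (\<lambda>w. U t (X t w)) \<le> a t + 4 * \<delta> + 2 * K"
proof -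
  have t': "t \<in> {1..T}" using t by auto
  let ?d = "ef_density (\<lambda>_. 1) \<alpha> U t"
  note int = distributed_integrable[OF action_distributed[OF t'] _ ef_density_nonneg]
  have "0 < g" using assms by simp
  then have "0 \<le> exp (- \<alpha> * g / 2) / (g / 8)" by simp
  then have K0: "0 \<le> K" by (rule order_trans[OF _ K])
  have int1: "integrable lborel ?d"
    using int[of "\<lambda>_. 1"] by simp
  have mass: "(LINT x|lborel. ?d x) = 1"
    using expectation_action[OF t', of "\<lambda>_. 1"] prob_space by simp
  have "expectation (\<lambda>w. U t (X t w)) = (LINT x|lborel. ?d x * U t x)"
    by (rule expectation_action[OF t']) simp
  also have "\<dots> \<le> (LINT x|lborel. ?d x * (a t + 4 * \<delta>) + indicator {0..1} x * (2 * K))"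
  proof (rule integral_mono)
    show "integrable lborel (\<lambda>x. ?d x * U t x)"
      using int[of "U t"] integrable_loss[OF t'] by simp
    show "integrable lborel (\<lambda>x. ?d x * (a t + 4 * \<delta>) + indicator {0..1} x * (2 * K))"
      using int1 by (intro Bochner_Integration.integrable_add integrable_mult_left) simp_all
    fix x :: real
    consider "x \<notin> {0..1}" | "0 \<le> x" "x \<le> \<delta>" | "\<delta> \<le> x" "x \<le> 1" by fastforce
    then show "?d x * U t x \<le> ?d x * (a t + 4 * \<delta>) + indicator {0..1} x * (2 * K)"
    proof cases
      case 1
      then show ?thesis by (simp add: ef_density_def)
    next
      case 2
      then have "?d x * U t x \<le> ?d x * (a t + 4 * \<delta>)"
        using U_near_0[OF t' \<open>B < 1 / 2\<close> 2 \<delta>(2)] ef_density_nonneg[of t x] by (intro mult_left_mono)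
      moreover have "0 \<le> indicator {0..1} x * (2 * K)" using K0 by simp
      ultimately show ?thesis by linarith
    next
      case 3
      have "U t x \<le> a t + 2"
        using loss_le[OF t', of x] a_bounds[OF t'] \<open>B < 1 / 2\<close> \<delta> 3 by simp
      then have "?d x * U t x \<le> ?d x * (a t + 4 * \<delta> + 2)"
        using \<delta> ef_density_nonneg[of t x] by (intro mult_left_mono) auto
      also have "\<dots> = ?d x * (a t + 4 * \<delta>) + ?d x * 2" by (simp add: algebra_simps)
      finally have "?d x * U t x \<le> ?d x * (a t + 4 * \<delta>) + ?d x * 2" .
      moreover have "?d x \<le> K"
        using ef_density_le_away_from_0[OF t \<open>B < 1 / 2\<close> \<delta> 3] K g by simp
      ultimately show ?thesis using 3 \<delta> by simp
    qed
  qed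
  also have "\<dots> = a t + 4 * \<delta> + 2 * K"
    using int1 mass by simp
  finally show ?thesis .
qed

lemma expectation_first_loss:
  assumes "1 \<le> T"
  shows "expectation (\<lambda>w. U 1 (X 1 w)) \<le> a 1 + (2 - 2 * ln (exp 1 - 1))"
proof -
  have 1: "1 \<in> {1..T}" using assms by simp
  have "expectation (\<lambda>w. U 1 (X 1 w)) = (LINT x|lborel. ef_density (\<lambda>_. 1) \<alpha> U 1 x * U 1 x)"
    by (rule expectation_action[OF 1]) simp
  also have "\<dots> = (LINT x:{0..1}|lborel. clipped_ratio (a 1) x)"
    unfolding set_lebesgue_integral_def using U_eq[OF 1]
    by (intro Bochner_Integration.integral_cong)
      (auto simp: ef_density_def ef_weight_def set_integral_const split: split_indicator)
  also have "\<dots> \<le> a 1 + (2 - 2 * ln (exp 1 - 1))"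
    by (rule set_integral_clipped_ratio_le[OF a_bounds(1)[OF 1]])
  finally show ?thesis .
qed

text \<open>The first round pays the cost of uniform sampling, each later one at most
  \<open>\<epsilon>\<close>; granting \<open>\<epsilon>\<close> to the first round too keeps the sum
  uniform.\<close>

lemma regret_le_large_step:
  fixes xm \<delta> \<epsilon> :: real
  assumes "1 \<le> T" "B < 1 / 2" "xm \<in> {0..1}" and \<delta>: "0 < \<delta>" "\<delta> \<le> 1 / 2"
    and "g = min \<delta> (1 - 2 * B)" "exp (- \<alpha> * g / 2) / (g / 8) \<le> K"
    and \<epsilon>: "4 * \<delta> + 2 * K \<le> \<epsilon>" "0 \<le> \<epsilon>"
  shows "(\<Sum>t=1..T. expectation (\<lambda>w. U t (X t w))) - (\<Sum>t=1..T. U t xm)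
    \<le> 2 - 2 * ln (exp 1 - 1) + T * \<epsilon>"
proof -
  let ?c = "2 - 2 * ln (exp 1 - 1) :: real"
  have "expectation (\<lambda>w. U t (X t w)) \<le> a t + ((if t = 1 then ?c else 0) + \<epsilon>)" if "t \<in> {1..T}" for t
  proof (cases "t = 1")
    case True
    then show ?thesis using expectation_first_loss[OF assms(1)] \<epsilon>(2) by simp
  next
    case False
    then show ?thesis
      using expectation_loss_concentrated[of t \<delta> g K] that assms by simp
  qed
  then have "(\<Sum>t=1..T. expectation (\<lambda>w. U t (X t w))) \<le> (\<Sum>t=1..T. a t + ((if t = 1 then ?c else 0) + \<epsilon>))"
    by (intro sum_mono)
  also have "\<dots> = (\<Sum>t=1..T. a t) + (?c + T * \<epsilon>)"
    using assms(1) by (simp add: sum.distrib)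
  finally show ?thesis
    using minimal_loss_ge[OF assms(2,3)] by simp
qed

text \<open>This step size minimizes \<open>ln T / \<alpha> + 2 * \<alpha> * T * B * B\<close>, the
  sum of the entropy term for an interval of length \<open>1 / T\<close> and the Hoeffding term for
  range \<open>4 * B\<close>. At the minimum both terms equal \<open>2 * B * S\<close>.\<close>

lemma regret_le_balanced_step:
  assumes "7 \<le> T" "1 / 2 \<le> B"
    and xm: "xm \<in> {0..1}" "\<And>x. x \<in> {0..1} \<Longrightarrow> (\<Sum>t=1..T. U t xm) \<le> (\<Sum>t=1..T. U t x)"
    and S: "S = sqrt (T / 2 * ln T)" and \<alpha>: "\<alpha> = S / (T * B)"
  shows "(\<Sum>t=1..T. expectation (\<lambda>w. U t (X t w))) - (\<Sum>t=1..T. U t xm) \<le> 21 / 2 + 4 * B * S"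
proof -
  have T: "0 < real T" "0 < ln (real T)" using assms(1) by auto
  then have "0 < S" by (simp add: S)
  have S2: "S * S = T / 2 * ln T" using T by (simp add: S)
  define w where "w = 1 / real T"
  have w: "0 < w" "w < 1 / 3" using assms(1) by (auto simp: w_def)
  obtain p where p: "0 \<le> p" "p + w \<le> 1"
    "\<And>y. y \<in> {p..p + w} \<Longrightarrow> (\<Sum>t=1..T. U t y) \<le> (\<Sum>t=1..T. U t xm) + 6 * T * w / (1 - 3 * w)"
    using near_best_interval[OF xm w] by metis
  have "(\<Sum>t=1..T. expectation (\<lambda>w. U t (X t w))) \<le>
      ((\<Sum>t=1..T. U t xm) + 6 * T * w / (1 - 3 * w)) + ln (1 / (p + w - p)) / \<alpha> +
      \<alpha> * T * (max 2 (1 + 2 * B))\<^sup>2 / 8"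
    using p w by (intro total_expected_loss_le) auto
  \<comment> \<open>With \<open>w = 1 / T\<close> this is \<open>6 / (1 - 3 / T)\<close>, which
    decreases in \<open>T\<close> and equals \<open>21 / 2\<close> at \<open>T = 7\<close>.\<close>
  moreover have "6 * T * w / (1 - 3 * w) \<le> 21 / 2"
    using assms(1) by (simp add: w_def field_simps)
  moreover have "ln (1 / (p + w - p)) / \<alpha> = 2 * B * S"
  proof -
    have "ln (1 / (p + w - p)) / \<alpha> = ln T * T * B / S"
      by (simp add: w_def \<alpha>)
    also have "\<dots> = 2 * B * (S * S) / S" unfolding S2 by simp
    finally show ?thesis using \<open>0 < S\<close> by simp
  qed
  moreover have "\<alpha> * T * (max 2 (1 + 2 * B))\<^sup>2 / 8 \<le> 2 * B * S"
  proof -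
    have "\<alpha> * T * (max 2 (1 + 2 * B))\<^sup>2 / 8 \<le> \<alpha> * T * (4 * B)\<^sup>2 / 8"
      using assms(2) step_pos by (intro divide_right_mono mult_left_mono power_mono) auto
    also have "\<dots> = 2 * B * S"
      using T assms(2) by (simp add: \<alpha> power2_eq_square)
    finally show ?thesis .
  qed
  ultimately show ?thesis by simp
qed

end

section \<open>Numerical inequalities and the two initial densities\<close>

lemma four_mult_le_sqrt:
  assumes "1 \<le> T" "T \<le> 6"
  shows "4 * real T \<le> 9 * (1 + sqrt (real T / 2 * ln (real T)))"
proof (cases "T \<le> 2")
  case True
  then have "4 * real T \<le> 9 * 1" by simp
  also have "\<dots> \<le> 9 * (1 + sqrt (real T / 2 * ln (real T)))"
    using assms by (intro mult_left_mono) auto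
  finally show ?thesis .
next
  case False
  then have "1 \<le> ln (real T)"
    using ln_mono[of "exp 1" "real T"] e_less_272 by simp
  then have "real T / 2 * 1 \<le> real T / 2 * ln (real T)" by (intro mult_left_mono) auto
  \<comment> \<open>As a quadratic inequality in \<open>T\<close> this holds between roots near
    \<open>0.81\<close> and \<open>6.22\<close>, hence up to \<open>6\<close>.\<close>
  moreover have "(4 * real T / 9 - 1)\<^sup>2 \<le> real T / 2"
    using mult_nonneg_nonneg[of "real T - 1" "6 - real T"] assms
    by (simp add: power2_eq_square algebra_simps)
  ultimately have "(4 * real T / 9 - 1)\<^sup>2 \<le> real T / 2 * ln (real T)" by simp
  then show ?thesis using real_le_rsqrt by fastforce
qed

text \<open>The constant solves \<open>(9 + 5 * S) / 2 = 21 / 2\<close>: it is the size of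
  \<open>S\<close> at which the bound absorbs the additive \<open>21 / 2\<close> already for
  \<open>B = 1 / 2\<close>.\<close>

lemma sqrt_half_log_ge:
  assumes "7 \<le> T"
  shows "12 / 5 \<le> sqrt (real T / 2 * ln (real T))"
proof -
  have "1 \<le> ln (3 :: real)"
    using ln_mono[of "exp 1" "3 :: real"] e_less_272 by simp
  then have "5 / 3 \<le> ln (6 :: real)"
    using ln_mult[of 2 "3 :: real"] ln2_ge_two_thirds by simp
  also have "\<dots> \<le> ln (real T)" using assms by (intro ln_mono) auto
  finally have "7 / 2 * (5 / 3) \<le> real T / 2 * ln (real T)"
    using assms by (intro mult_mono) auto
  then show ?thesis by (intro real_le_rsqrt) (simp add: power2_eq_square)
qed

lemma density_on_unit_uniform: "density_on_unit (\<lambda>_. 1)"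
  by (simp add: density_on_unit_def set_integral_const)

lemma density_on_unit_uniform_prefix:
  assumes "0 < \<delta>" "\<delta> \<le> 1"
  shows "density_on_unit (\<lambda>x. indicator {0..\<delta>} x / \<delta>)"
proof -
  have "(LINT x:{0..1}|lborel. indicator {0..\<delta>} x / \<delta>) = (LINT x|lborel. indicator {0..\<delta>} x / \<delta>)"
    unfolding set_lebesgue_integral_def using assms
    by (intro Bochner_Integration.integral_cong) (auto split: split_indicator)
  then show ?thesis using assms by (simp add: density_on_unit_def)
qed

theorem corollary6p1:
  fixes B :: real and T :: nat
  assumes "0 < B" and "1 \<le> T"
  shows "\<exists>\<rho>1 \<alpha>. density_on_unit \<rho>1 \<and> (1 \<le> regret_bound B T \<longrightarrow> \<rho>1 = (\<lambda>_. 1)) \<and> 0 < \<alpha> \<and>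
    (\<forall>(n :: nat \<Rightarrow> nat) (\<eta> :: nat \<Rightarrow> real) (M :: 'w measure) X.
      (\<forall>t\<in>{1..T}. 1 \<le> n t \<and> 0 \<le> \<eta> t \<and> \<eta> t / real (n t) \<le> B) \<longrightarrow>
      exponential_forecaster M \<rho>1 \<alpha> (\<lambda>t. sched_ratio_bound (n t) (\<eta> t)) T X \<longrightarrow>
      (\<exists>xm\<in>{0..1}.
        (\<forall>x\<in>{0..1}. expected_regret M (\<lambda>t. sched_ratio_bound (n t) (\<eta> t)) T X x
                   \<le> expected_regret M (\<lambda>t. sched_ratio_bound (n t) (\<eta> t)) T X xm) \<and>
        expected_regret M (\<lambda>t. sched_ratio_bound (n t) (\<eta> t)) T X xm \<le> regret_bound B T))"
proof -
  define R where "R = regret_bound B T"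
  define S where "S = sqrt (real T / 2 * ln (real T))"
  have "0 \<le> S" using assms by (simp add: S_def)
  have R: "R = 9 * B * (1 + S)" by (simp add: R_def regret_bound_def S_def)
  have "9 * B * 1 \<le> R" unfolding R using assms \<open>0 \<le> S\<close> by (intro mult_left_mono) auto
  then have "9 * B \<le> R" "0 < R" using assms by auto
  \<comment> \<open>It remains to name an initial density and a step size depending on
    \<open>B\<close> and \<open>T\<close> alone, and to bound the regret against a minimizer of the
    cumulative loss.\<close>
  have reduce: ?thesis if "density_on_unit \<rho>1" "1 \<le> R \<longrightarrow> \<rho>1 = (\<lambda>_. 1)" "0 < \<alpha>"
    and regret: "\<And>n \<eta> (M :: 'w measure) X xm. \<lbrakk>scheduling_run B T n \<eta> M \<rho>1 \<alpha> X; xm \<in> {0..1};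
      \<And>x. x \<in> {0..1} \<Longrightarrow> (\<Sum>t=1..T. sched_ratio_bound (n t) (\<eta> t) xm) \<le>
        (\<Sum>t=1..T. sched_ratio_bound (n t) (\<eta> t) x)\<rbrakk> \<Longrightarrow>
      (\<Sum>t=1..T. LINT w|M. sched_ratio_bound (n t) (\<eta> t) (X t w)) -
        (\<Sum>t=1..T. sched_ratio_bound (n t) (\<eta> t) xm) \<le> R"
    for \<rho>1 \<alpha>
  proof (rule exI[of _ \<rho>1], rule exI[of _ \<alpha>], intro conjI allI impI that(1-3))
    show "\<rho>1 = (\<lambda>_. 1)" if "1 \<le> regret_bound B T"
      using that \<open>1 \<le> R \<longrightarrow> _\<close> by (simp add: R_def)
    fix n \<eta> X and M :: "'w measure"
    assume inst: "\<forall>t\<in>{1..T}. 1 \<le> n t \<and> 0 \<le> \<eta> t \<and> \<eta> t / real (n t) \<le> B"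
      and ef: "exponential_forecaster M \<rho>1 \<alpha> (\<lambda>t. sched_ratio_bound (n t) (\<eta> t)) T X"
    interpret scheduling_instances B T n \<eta>
      using inst by unfold_locales auto
    interpret prob_space M
      using ef by (simp add: exponential_forecaster_def)
    have run: "forecaster_run U T (\<lambda>t. min (a t) 2) range_width M \<rho>1 \<alpha> X"
      using that(1) ef by unfold_locales
    have "scheduling_run B T n \<eta> M \<rho>1 \<alpha> X"
      unfolding scheduling_run_def using run scheduling_instances_axioms by simp
    from regret_max_attained[OF run, of R] regret[OF this]
    show "\<exists>xm\<in>{0..1}. (\<forall>x\<in>{0..1}. expected_regret M U T X x \<le> expected_regret M U T X xm) \<and>
        expected_regret M U T X xm \<le> regret_bound B T"
      by (simp add: R_def)
  qed
  have uniform: "uniform_scheduling_run B T n \<eta> M \<alpha> X"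
    if "scheduling_run B T n \<eta> M (\<lambda>_. 1) \<alpha> X" "0 < \<alpha>" for n \<eta> and M :: "'w measure" and \<alpha> X
    using that by (simp add: scheduling_run_def uniform_scheduling_run_def
        uniform_forecaster_run_def uniform_forecaster_run_axioms_def)
  consider "R < 1" | "1 \<le> R" "B < 1 / 2" | "1 / 2 \<le> B" "T \<le> 6" | "1 / 2 \<le> B" "7 \<le> T"
    by linarith
  then show ?thesis
  proof cases
    case 1
    \<comment> \<open>Chosen so that the bound \<open>4 * \<delta> * T\<close> of
      \<open>regret_le_near_0\<close> is exactly \<open>R\<close>.\<close>
    define \<delta> where "\<delta> = R / (4 * T)"
    have "R * 2 \<le> 1 * (4 * real T)" using 1 \<open>0 < R\<close> assms(2) by (intro mult_mono) auto
    then have \<delta>: "0 < \<delta>" "\<delta> \<le> 1 / 2" "4 * \<delta> * T = R"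
      using \<open>0 < R\<close> assms(2) by (auto simp: \<delta>_def field_simps)
    have "B < 1 / 2" using 1 \<open>9 * B \<le> R\<close> by simp
    show ?thesis
    proof (rule reduce[of "\<lambda>x. indicator {0..\<delta>} x / \<delta>" 1])
      fix n \<eta> X xm and M :: "'w measure"
      assume run: "scheduling_run B T n \<eta> M (\<lambda>x. indicator {0..\<delta>} x / \<delta>) 1 X" and xm: "xm \<in> {0..1::real}"
      interpret scheduling_run B T n \<eta> M "\<lambda>x. indicator {0..\<delta>} x / \<delta>" 1 X by (rule run)
      have "x \<le> \<delta>" if "indicator {0..\<delta>} x / \<delta> \<noteq> 0" for x :: real
        using that by (simp add: indicator_def split: if_splits)
      from regret_le_near_0[OF \<open>B < 1 / 2\<close> less_imp_le[OF \<delta>(1)] \<delta>(2) xm this]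
      show "(\<Sum>t=1..T. LINT w|M. U t (X t w)) - (\<Sum>t=1..T. U t xm) \<le> R"
        unfolding \<delta>(3) .
    qed (use 1 \<delta> in \<open>auto intro: density_on_unit_uniform_prefix\<close>)
  next
    case 2
    \<comment> \<open>The slack between the first-round cost and \<open>1\<close>, shared equally
      among the rounds.\<close>
    define \<epsilon> :: real where "\<epsilon> = (1 - (2 - 2 * ln (exp 1 - 1))) / T"
    have \<epsilon>: "0 < \<epsilon>" "2 - 2 * ln (exp 1 - 1) + T * \<epsilon> = 1"
      using first_round_constant_less_1 assms(2) by (auto simp: \<epsilon>_def)
    define \<delta> where "\<delta> = min (1 / 2) (\<epsilon> / 8)"
    define g where "g = min \<delta> (1 - 2 * B)"
    \<comment> \<open>Large enough that the density bound \<open>K\<close> is at most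
      \<open>\<epsilon> / 4\<close>; together with \<open>\<delta> \<le> \<epsilon> / 8\<close> this
      gives \<open>4 * \<delta> + 2 * K \<le> \<epsilon>\<close>. The maximum with \<open>1\<close>
      keeps it positive.\<close>
    define \<alpha> where "\<alpha> = max 1 (- 2 * ln (g / 8 * (\<epsilon> / 4)) / g)"
    have \<delta>: "0 < \<delta>" "\<delta> \<le> 1 / 2" "4 * \<delta> + 2 * (\<epsilon> / 4) \<le> \<epsilon>" using \<epsilon> by (auto simp: \<delta>_def)
    have "0 < g" using \<delta> 2 by (simp add: g_def)
    have "- 2 * ln (g / 8 * (\<epsilon> / 4)) / g \<le> \<alpha>" by (simp add: \<alpha>_def)
    then have "- \<alpha> * g / 2 \<le> ln (g / 8 * (\<epsilon> / 4))"
      using \<open>0 < g\<close> by (simp add: field_simps)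
    then have "exp (- \<alpha> * g / 2) \<le> g / 8 * (\<epsilon> / 4)"
      using \<open>0 < g\<close> \<epsilon> by (subst (asm) ln_ge_iff) auto
    then have K: "exp (- \<alpha> * g / 2) / (g / 8) \<le> \<epsilon> / 4"
      using \<open>0 < g\<close> by (simp add: field_simps)
    show ?thesis
    proof (rule reduce[of "\<lambda>_. 1" \<alpha>])
      show "0 < \<alpha>" by (simp add: \<alpha>_def)
      fix n \<eta> X xm and M :: "'w measure"
      assume run: "scheduling_run B T n \<eta> M (\<lambda>_. 1) \<alpha> X" and xm: "xm \<in> {0..1::real}"
      interpret uniform_scheduling_run B T n \<eta> M \<alpha> X by (rule uniform[OF run \<open>0 < \<alpha>\<close>])
      show "(\<Sum>t=1..T. LINT w|M. U t (X t w)) - (\<Sum>t=1..T. U t xm) \<le> R"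
        using regret_le_large_step[OF assms(2) 2(2) xm \<delta>(1,2) g_def K \<delta>(3)] \<epsilon> 2(1) by simp
    qed (auto intro: density_on_unit_uniform)
  next
    case 3
    show ?thesis
    proof (rule reduce[of "\<lambda>_. 1" 1])
      fix n \<eta> X xm and M :: "'w measure"
      assume run: "scheduling_run B T n \<eta> M (\<lambda>_. 1) 1 X" and xm: "xm \<in> {0..1::real}"
      interpret scheduling_run B T n \<eta> M "\<lambda>_. 1" 1 X by (rule run)
      have "max 2 (1 + 2 * B) * T \<le> 4 * B * T"
        using 3 by (intro mult_right_mono) auto
      also have "\<dots> = B * (4 * real T)" by simp
      also have "\<dots> \<le> B * (9 * (1 + S))"
        unfolding S_def using assms 3
        by (intro mult_left_mono[OF four_mult_le_sqrt]) auto
      also have "\<dots> = R" by (simp add: R)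
      finally show "(\<Sum>t=1..T. LINT w|M. U t (X t w)) - (\<Sum>t=1..T. U t xm) \<le> R"
        using regret_le_range[OF xm] by simp
    qed (auto intro: density_on_unit_uniform)
  next
    case 4
    have "12 / 5 \<le> S" unfolding S_def by (rule sqrt_half_log_ge[OF 4(2)])
    then have "1 / 2 * (9 + 5 * (12 / 5)) \<le> B * (9 + 5 * S)"
      using 4 by (intro mult_mono) auto
    \<comment> \<open>The difference \<open>R - 4 * B * S\<close> is
      \<open>B * (9 + 5 * S)\<close>.\<close>
    then have le_R: "21 / 2 + 4 * B * S \<le> R" by (simp add: R algebra_simps)
    show ?thesis
    proof (rule reduce[of "\<lambda>_. 1" "S / (T * B)"])
      show "0 < S / (T * B)" using \<open>12 / 5 \<le> S\<close> assms by simp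
      fix n \<eta> X xm and M :: "'w measure"
      assume run: "scheduling_run B T n \<eta> M (\<lambda>_. 1) (S / (T * B)) X" and xm: "xm \<in> {0..1::real}"
        "\<And>x. x \<in> {0..1} \<Longrightarrow> (\<Sum>t=1..T. sched_ratio_bound (n t) (\<eta> t) xm) \<le>
          (\<Sum>t=1..T. sched_ratio_bound (n t) (\<eta> t) x)"
      interpret uniform_scheduling_run B T n \<eta> M "S / (T * B)" X
        by (rule uniform[OF run \<open>0 < S / (T * B)\<close>])
      show "(\<Sum>t=1..T. LINT w|M. U t (X t w)) - (\<Sum>t=1..T. U t xm) \<le> R"
        using regret_le_balanced_step[OF 4(2,1) xm S_def refl] le_R by simp
    qed (auto intro: density_on_unit_uniform)
  qed
qed

end
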